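(* Let $\Omega=B_2\subset\mathbb R^2$ and fix any $\gamma\ge0$. There exists $\gamma_*=\gamma_*(\gamma)>0$ such that, for every $\gamma_0\ge\gamma_*$, one can find $u,f\in C^\infty(\overline\Omega)$ satisfying $$\Delta^2u-\gamma\Delta u+\gamma_0u=f\ge0\quad\text{in }\Omega,\qquad u>0,\quad\partial_\nu u<0\quad\text{on }\partial\Omega,$$ while $u\ge0$ in $\Omega$ and $u$ vanishes on the interior circle $\{|x|=1\}$. In addition, $f$ vanishes on that circle and is not identically zero.
   Context: $B_2$ is the open disk of radius $2$ centered at the origin and $\partial_\nu$ is the outward normal derivative on $\partial\Omega$. *)

theory Defs
  imports "HOL-Analysis.Analysis"
begin

definition partial_deriv :: "'a::euclidean_space \<Rightarrow> ('a \<Rightarrow> real) \<Rightarrow> 'a \<Rightarrow> real" where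
  "partial_deriv b u x = frechet_derivative u (at x) b"

definition iter_partial :: "'a::euclidean_space list \<Rightarrow> ('a \<Rightarrow> real) \<Rightarrow> 'a \<Rightarrow> real" where
  "iter_partial bs u = foldr partial_deriv bs u"

definition laplacian :: "('a::euclidean_space \<Rightarrow> real) \<Rightarrow> 'a \<Rightarrow> real" where
  "laplacian u x = (\<Sum>b\<in>Basis. partial_deriv b (partial_deriv b u) x)"

(* C^infinity on the closure of an open set: u is smooth in Omega and each of its partial
   derivatives (u itself included) extends continuously to the closure; the extension of u
   itself is u, so u is a function on the closure.  Values of u outside the closure of Omega
   play no role. *)
definition smooth_up_to_boundary :: "'a::euclidean_space set \<Rightarrow> ('a \<Rightarrow> real) \<Rightarrow> bool" where
  "smooth_up_to_boundary \<Omega> u \<longleftrightarrow>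
     continuous_on (closure \<Omega>) u \<and>
     (\<forall>bs\<in>lists Basis.
        iter_partial bs u differentiable_on \<Omega> \<and>
        (\<exists>g. continuous_on (closure \<Omega>) g \<and> (\<forall>x\<in>\<Omega>. g x = iter_partial bs u x)))"

(* Derivative of u at the boundary point x in the direction nu of the outward unit normal.
   It is taken from the left, where the line x + t nu runs inside the domain, since u is
   meaningful only on the closure of the domain. *)
definition normal_deriv :: "('a::euclidean_space \<Rightarrow> 'a) \<Rightarrow> ('a \<Rightarrow> real) \<Rightarrow> 'a \<Rightarrow> real" where
  "normal_deriv \<nu> u x = vector_derivative (\<lambda>t. u (x + t *\<^sub>R \<nu> x)) (at_left 0)"

definition ball_outward_normal :: "'a::euclidean_space \<Rightarrow> 'a \<Rightarrow> 'a" where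
  "ball_outward_normal c x = (x - c) /\<^sub>R norm (x - c)"

end

theory Submission
  imports Defs
begin

text \<open>
  The example is radial and polynomial. With \<open>t = |x|\<^sup>2 - 1\<close>, which ranges over \<open>[-1, 3]\<close> on the closed
  disk, put \<open>u = t\<^sup>6 (13 - 4 t)\<close>. The sixth power makes \<open>u\<close> vanish on the unit circle, and there the
  fourth-order part dominates: \<open>\<Delta>\<^sup>2 u\<close> vanishes only to second order with a positive leading
  coefficient, whereas \<open>\<Delta> u\<close> and \<open>u\<close> vanish to orders four and six. Hence
  \<open>f = \<Delta>\<^sup>2 u - \<gamma> \<Delta> u + \<gamma>\<^sub>0 u\<close> is \<open>t\<^sup>2\<close> times \<open>A(t) + \<gamma>\<^sub>0 B(t)\<close>, where \<open>A(0) > 0\<close> and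
  \<open>B = t\<^sup>4 (13 - 4 t)\<close> is positive for \<open>t \<noteq> 0\<close>. By compactness of \<open>[-1, 3]\<close> the bracket is positive
  for all large \<open>\<gamma>\<^sub>0\<close> (lemma \<open>eventually_pos_add_multiple\<close>), so \<open>f \<ge> 0\<close> with equality
  exactly on the circle.

  The linear factor \<open>13 - 4 t\<close> serves the boundary: it stays at least \<open>1\<close> on \<open>[-1, 3]\<close>, but it
  decreases fast enough near \<open>t = 3\<close> to make \<open>u\<close> decrease there in spite of the growing \<open>t\<^sup>6\<close>.

  As \<open>u\<close> is a polynomial in \<open>x \<bullet> x\<close>, the Laplacian acts on it as an ordinary differential operator on
  univariate polynomials (lemma \<open>laplacian_poly_inner\<close>), and smoothness up to the
  boundary comes from the fact that partial derivatives of polynomials are polynomials.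
\<close>

lemma real_polynomial_function_has_derivative:
  fixes p :: "'a::euclidean_space \<Rightarrow> real"
  assumes "real_polynomial_function p"
  shows "\<exists>p'. (\<forall>x. (p has_derivative p' x) (at x)) \<and>
              (\<forall>b. real_polynomial_function (\<lambda>x. p' x b))"
  using assms
proof (induction p rule: real_polynomial_function.induct)
  case (linear h)
  then have "\<forall>x. (h has_derivative h) (at x)"
    by (auto intro: bounded_linear_imp_has_derivative)
  then show ?case
    by (intro exI[of _ "\<lambda>x. h"]) (auto intro: real_polynomial_function.intros)
next
  case (const c)
  show ?case
    by (intro exI[of _ "\<lambda>x y. 0"]) (auto intro: real_polynomial_function.intros)
next
  case (add f g)
  then obtain f' g' where
    "\<forall>x. (f has_derivative f' x) (at x)" "\<forall>b. real_polynomial_function (\<lambda>x. f' x b)"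
    "\<forall>x. (g has_derivative g' x) (at x)" "\<forall>b. real_polynomial_function (\<lambda>x. g' x b)"
    by blast
  then show ?case
    by (intro exI[of _ "\<lambda>x y. f' x y + g' x y"])
      (auto intro: real_polynomial_function.intros has_derivative_add)
next
  case (mult f g)
  then obtain f' g' where
    "\<forall>x. (f has_derivative f' x) (at x)" "\<forall>b. real_polynomial_function (\<lambda>x. f' x b)"
    "\<forall>x. (g has_derivative g' x) (at x)" "\<forall>b. real_polynomial_function (\<lambda>x. g' x b)"
    by blast
  then show ?case using mult.hyps
    by (intro exI[of _ "\<lambda>x y. f x * g' x y + f' x y * g x"])
      (auto intro!: real_polynomial_function.intros(3,4) has_derivative_mult)
qed

lemma real_polynomial_function_partial_deriv:
  assumes "real_polynomial_function p"
  shows "real_polynomial_function (partial_deriv b p)"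
proof -
  obtain p' where p': "\<And>x. (p has_derivative p' x) (at x)"
    "real_polynomial_function (\<lambda>x. p' x b)"
    using real_polynomial_function_has_derivative[OF assms] by blast
  have "partial_deriv b p = (\<lambda>x. p' x b)"
    unfolding partial_deriv_def using frechet_derivative_at[OF p'(1)] by simp
  then show ?thesis using p'(2) by simp
qed

lemma real_polynomial_function_iter_partial:
  assumes "real_polynomial_function p"
  shows "real_polynomial_function (iter_partial bs p)"
  unfolding iter_partial_def
  by (induction bs) (auto simp: assms real_polynomial_function_partial_deriv)

lemma smooth_up_to_boundary_polynomial:
  assumes "real_polynomial_function p"
  shows "smooth_up_to_boundary \<Omega> p"
proof -
  have diff: "q differentiable_on S" if "real_polynomial_function q" for q :: "'a \<Rightarrow> real" and S
    using real_polynomial_function_has_derivative[OF that]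
    by (meson differentiable_at_imp_differentiable_on differentiableI)
  have "iter_partial bs p differentiable_on S" for bs S
    by (intro diff real_polynomial_function_iter_partial assms)
  then show ?thesis
    unfolding smooth_up_to_boundary_def
    using diff[OF assms] differentiable_imp_continuous_on by blast
qed

lemma real_polynomial_function_poly_inner:
  "real_polynomial_function (\<lambda>x::'a::euclidean_space. poly p (x \<bullet> x))"
proof -
  have "real_polynomial_function (\<lambda>x::'a. x \<bullet> x)"
    by (subst euclidean_inner)
      (intro real_polynomial_function_sum finite_Basis real_polynomial_function.intros(1,4)
        bounded_linear_inner_left)
  then show ?thesis
    by (induction p) (auto intro!: real_polynomial_function.intros(2-4))
qed

lemma partial_deriv_poly_inner:
  fixes b :: "'a::euclidean_space"
  shows "partial_deriv b (\<lambda>x. poly p (x \<bullet> x)) = (\<lambda>x. 2 * (x \<bullet> b) * poly (pderiv p) (x \<bullet> x))"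
proof
  fix x :: 'a
  have "((\<lambda>x. x \<bullet> x) has_derivative (\<lambda>y. 2 * (x \<bullet> y))) (at x)"
    by (auto intro!: derivative_eq_intros simp: inner_commute)
  then have "((\<lambda>x. poly p (x \<bullet> x)) has_derivative
      (\<lambda>y. 2 * (x \<bullet> y) * poly (pderiv p) (x \<bullet> x))) (at x)"
    using DERIV_compose_FDERIV[OF poly_DERIV] by blast
  from frechet_derivative_at[OF this]
  show "partial_deriv b (\<lambda>x. poly p (x \<bullet> x)) x = 2 * (x \<bullet> b) * poly (pderiv p) (x \<bullet> x)"
    unfolding partial_deriv_def by metis
qed

lemma partial_deriv2_poly_inner:
  assumes "b \<in> Basis"
  shows "partial_deriv b (partial_deriv b (\<lambda>x. poly p (x \<bullet> x))) x =
    2 * poly (pderiv p) (x \<bullet> x) + 4 * (x \<bullet> b)\<^sup>2 * poly (pderiv (pderiv p)) (x \<bullet> x)"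
proof -
  have "((\<lambda>x. x \<bullet> x) has_derivative (\<lambda>y. 2 * (x \<bullet> y))) (at x)"
    by (auto intro!: derivative_eq_intros simp: inner_commute)
  then have "((\<lambda>x. poly (pderiv p) (x \<bullet> x)) has_derivative
      (\<lambda>y. 2 * (x \<bullet> y) * poly (pderiv (pderiv p)) (x \<bullet> x))) (at x)"
    using DERIV_compose_FDERIV[OF poly_DERIV] by blast
  then have "((\<lambda>x. 2 * (x \<bullet> b) * poly (pderiv p) (x \<bullet> x)) has_derivative
      (\<lambda>y. 2 * (x \<bullet> b) * (2 * (x \<bullet> y) * poly (pderiv (pderiv p)) (x \<bullet> x)) +
           2 * (y \<bullet> b) * poly (pderiv p) (x \<bullet> x))) (at x)"
    by (auto intro!: derivative_eq_intros)
  from frechet_derivative_at[OF this, symmetric]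
  show ?thesis
    unfolding partial_deriv_poly_inner unfolding partial_deriv_def
    using assms by (simp add: power2_eq_square)
qed

text \<open>The operator \<open>2 n d/ds + 4 s d\<^sup>2/ds\<^sup>2\<close>: the Laplacian of dimension \<open>n\<close> on functions of
  \<open>s = x \<bullet> x\<close>. The variable \<open>s\<close> rather than \<open>|x|\<close> keeps the radial operator within polynomials.\<close>

definition radial_laplacian :: "nat \<Rightarrow> real poly \<Rightarrow> real poly" where
  "radial_laplacian n p =
     smult (2 * real n) (pderiv p) + [:0, 4:] * pderiv (pderiv p)"

lemma laplacian_poly_inner:
  "laplacian (\<lambda>x::'a::euclidean_space. poly p (x \<bullet> x)) =
   (\<lambda>x. poly (radial_laplacian DIM('a) p) (x \<bullet> x))"
proof
  fix x :: 'a
  have "laplacian (\<lambda>x::'a. poly p (x \<bullet> x)) x =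
     (\<Sum>b\<in>Basis. 2 * poly (pderiv p) (x \<bullet> x) +
        4 * (x \<bullet> b)\<^sup>2 * poly (pderiv (pderiv p)) (x \<bullet> x))"
    unfolding laplacian_def by (intro sum.cong) (auto simp: partial_deriv2_poly_inner)
  also have "\<dots> = 2 * real DIM('a) * poly (pderiv p) (x \<bullet> x) +
       4 * (\<Sum>b\<in>Basis. (x \<bullet> b)\<^sup>2) * poly (pderiv (pderiv p)) (x \<bullet> x)"
    by (simp add: sum.distrib sum_distrib_left sum_distrib_right)
  also have "(\<Sum>b\<in>Basis. (x \<bullet> b)\<^sup>2) = x \<bullet> x"
    by (subst euclidean_inner) (simp add: power2_eq_square)
  finally show "laplacian (\<lambda>x::'a. poly p (x \<bullet> x)) x =
      poly (radial_laplacian DIM('a) p) (x \<bullet> x)"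
    by (simp add: radial_laplacian_def)
qed

lemma normal_deriv_poly_inner:
  assumes "x \<noteq> 0"
  shows "normal_deriv (ball_outward_normal 0) (\<lambda>x. poly p (x \<bullet> x)) x =
    2 * norm x * poly (pderiv p) (x \<bullet> x)"
proof -
  let ?r = "norm x"
  have r: "(x + t *\<^sub>R ball_outward_normal 0 x) \<bullet> (x + t *\<^sub>R ball_outward_normal 0 x) = (?r + t)\<^sup>2" for t
  proof -
    have "x + t *\<^sub>R ball_outward_normal 0 x = ((?r + t) / ?r) *\<^sub>R x"
      using assms by (simp add: ball_outward_normal_def add_divide_distrib scaleR_add_left inverse_eq_divide)
    then show ?thesis
      using assms by (simp add: dot_square_norm power2_eq_square)
  qed
  have "((\<lambda>t. (?r + t)\<^sup>2) has_real_derivative 2 * ?r) (at 0 within {..<0})"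
    by (auto intro!: derivative_eq_intros)
  from DERIV_chain2[OF poly_DERIV this, of p]
  have "((\<lambda>t. poly p ((?r + t)\<^sup>2)) has_vector_derivative 2 * ?r * poly (pderiv p) (x \<bullet> x))
      (at_left 0)"
    by (simp add: has_real_derivative_iff_has_vector_derivative dot_square_norm mult.commute)
  then show ?thesis
    unfolding normal_deriv_def r
    by (intro vector_derivative_within) (auto simp: trivial_limit_at_left_real)
qed

text \<open>On the compact set where \<open>A \<le> 0\<close> the function \<open>B\<close> is positive, so \<open>-A / B\<close> is bounded
  there, and any \<open>k\<close> above the bound works; where \<open>A > 0\<close> every \<open>k \<ge> 0\<close> works.\<close>

lemma eventually_pos_add_multiple:
  fixes A B :: "'a::topological_space \<Rightarrow> real"
  assumes "compact K" and A: "continuous_on K A" and B: "continuous_on K B"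
    and B_nonneg: "\<And>t. t \<in> K \<Longrightarrow> B t \<ge> 0"
    and pos: "\<And>t. t \<in> K \<Longrightarrow> B t = 0 \<Longrightarrow> A t > 0"
  shows "\<exists>c>0. \<forall>k\<ge>c. \<forall>t\<in>K. A t + k * B t > 0"
proof -
  define S where "S = {t\<in>K. A t \<le> 0}"
  have "\<exists>T. closed T \<and> T \<inter> K = A -` {..0} \<inter> K"
    using A continuous_on_closed_invariant closed_atMost by blast
  then obtain T where "closed T" "T \<inter> K = A -` {..0} \<inter> K" by blast
  then have "S = K \<inter> T" unfolding S_def by auto
  then have "compact S" using \<open>compact K\<close> \<open>closed T\<close> by (simp add: compact_Int_closed)
  have B_pos: "B t > 0" if "t \<in> S" for t
    using that B_nonneg[of t] pos[of t] unfolding S_def by force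
  have "S \<subseteq> K" unfolding S_def by auto
  then have "continuous_on S (\<lambda>t. - A t / B t)"
    using B_pos by (intro continuous_intros continuous_on_subset[OF A] continuous_on_subset[OF B]) force+
  then have "bounded ((\<lambda>t. - A t / B t) ` S)"
    using \<open>compact S\<close> compact_continuous_image compact_imp_bounded by blast
  then obtain M where "M > 0" and M: "\<And>t. t \<in> S \<Longrightarrow> \<bar>- A t / B t\<bar> \<le> M"
    unfolding bounded_pos by auto
  have "A t + k * B t > 0" if k: "k \<ge> M + 1" and "t \<in> K" for k t
  proof (cases "t \<in> S")
    case True
    then have "- A t / B t < k" using M[OF True] k by linarith
    then show ?thesis using B_pos[OF True] by (simp add: field_simps)
  next
    case False
    then have "A t > 0" using \<open>t \<in> K\<close> unfolding S_def by auto
    moreover have "k * B t \<ge> 0" using B_nonneg[OF \<open>t \<in> K\<close>] k \<open>M > 0\<close> by simp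
    ultimately show ?thesis by linarith
  qed
  then show ?thesis using \<open>M > 0\<close> by (intro exI[of _ "M + 1"]) auto
qed

text \<open>The function \<open>t\<^sup>6 (13 - 4 t)\<close> of the introduction, in the variable \<open>s = t + 1\<close>.\<close>

definition profile :: "real poly" where
  "profile = [:-1, 1:] ^ 6 * [:17, -4:]"

lemma poly_profile: "poly profile s = (s - 1) ^ 6 * (17 - 4 * s)"
  by (simp add: profile_def algebra_simps)

text \<open>In coefficient form derivatives are evaluated by rewriting, and the identities below become
  ring identities.\<close>

lemma profile_coeffs: "profile = [:17, -106, 279, -400, 335, -162, 41, -4:]"
  by (simp add: profile_def eval_nat_numeral)

lemma poly_radial_laplacian_profile:
  "poly (radial_laplacian 2 profile) s =
     4 * (s - 1) ^ 4 * (390 + 300 * (s - 1) - 196 * (s - 1) ^ 2)"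
  unfolding profile_coeffs radial_laplacian_def
  by (simp add: pderiv_pCons) algebra

lemma poly_radial_bilaplacian_profile:
  "poly (radial_laplacian 2 (radial_laplacian 2 profile)) s =
     16 * (s - 1) ^ 2 * (4680 + 12240 * (s - 1) + 1620 * (s - 1) ^ 2 - 7056 * (s - 1) ^ 3)"
  unfolding profile_coeffs radial_laplacian_def
  by (simp add: pderiv_pCons) algebra

text \<open>Dividing by \<open>(s - 1)\<^sup>2\<close> is what makes the compactness argument applicable: the undivided \<open>f\<close>
  has no positive term at \<open>s = 1\<close>, while the quotient has \<open>16 * 4680\<close> there, coming from the
  bilaplacian alone.\<close>

lemma profile_operator_factors:
  "\<exists>c>0. \<forall>k\<ge>c. \<exists>q. (\<forall>s\<in>{0..4}. q s > 0) \<and>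
     (\<forall>s. poly (radial_laplacian 2 (radial_laplacian 2 profile)
            - smult \<gamma> (radial_laplacian 2 profile) + smult k profile) s = (s - 1)\<^sup>2 * q s)"
proof -
  let ?A = "\<lambda>s::real. 16 * (4680 + 12240 * (s - 1) + 1620 * (s - 1) ^ 2 - 7056 * (s - 1) ^ 3)
      - \<gamma> * (4 * (s - 1)\<^sup>2 * (390 + 300 * (s - 1) - 196 * (s - 1) ^ 2))"
  let ?B = "\<lambda>s::real. (s - 1) ^ 4 * (17 - 4 * s)"
  have "\<exists>c>0. \<forall>k\<ge>c. \<forall>s\<in>{0..4}. ?A s + k * ?B s > 0"
  proof (rule eventually_pos_add_multiple)
    show "continuous_on {0..4} ?A" "continuous_on {0..4} ?B"
      by (intro continuous_intros)+
    show "?B s \<ge> 0" if "s \<in> {0..4}" for s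
      using that by simp
    show "?A s > 0" if "s \<in> {0..4}" "?B s = 0" for s
    proof -
      have "s = 1" using that by auto
      then show ?thesis by simp
    qed
  qed simp
  moreover have "poly (radial_laplacian 2 (radial_laplacian 2 profile)
      - smult \<gamma> (radial_laplacian 2 profile) + smult k profile) s = (s - 1)\<^sup>2 * (?A s + k * ?B s)"
    for k s
    by (simp add: poly_profile poly_radial_laplacian_profile poly_radial_bilaplacian_profile) algebra
  ultimately show ?thesis
    by (elim exE conjE) (intro exI conjI allI impI; blast)
qed

theorem mainTheorem4:
  fixes \<gamma> :: real and \<Omega> :: "(real^2) set"
  assumes "\<gamma> \<ge> 0" and "\<Omega> = ball 0 2"
  shows "\<exists>\<gamma>s>0. \<forall>\<gamma>0\<ge>\<gamma>s. \<exists>u f :: real^2 \<Rightarrow> real.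
           smooth_up_to_boundary \<Omega> u \<and> smooth_up_to_boundary \<Omega> f \<and>
           (\<forall>x\<in>\<Omega>. laplacian (laplacian u) x - \<gamma> * laplacian u x + \<gamma>0 * u x = f x \<and> f x \<ge> 0) \<and>
           (\<forall>x\<in>frontier \<Omega>. u x > 0 \<and> normal_deriv (ball_outward_normal 0) u x < 0) \<and>
           (\<forall>x\<in>\<Omega>. u x \<ge> 0) \<and>
           (\<forall>x. norm x = 1 \<longrightarrow> u x = 0) \<and>
           (\<forall>x. norm x = 1 \<longrightarrow> f x = 0) \<and>
           (\<exists>x\<in>\<Omega>. f x \<noteq> 0)"
proof -
  let ?L = "\<lambda>k. radial_laplacian 2 (radial_laplacian 2 profile)
      - smult \<gamma> (radial_laplacian 2 profile) + smult k profile"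
  obtain c where "c > 0" and c: "\<forall>k\<ge>c. \<exists>q. (\<forall>s\<in>{0..4}. q s > 0) \<and>
      (\<forall>s. poly (?L k) s = (s - 1)\<^sup>2 * q s)"
    using profile_operator_factors by blast
  show ?thesis
  proof (intro exI[of _ c] conjI allI impI)
    fix k assume "k \<ge> c"
    then obtain q where q: "\<And>s. 0 \<le> s \<Longrightarrow> s \<le> 4 \<Longrightarrow> q s > 0"
      and f_eq: "\<And>s. poly (?L k) s = (s - 1)\<^sup>2 * q s"
      using c by (meson atLeastAtMost_iff)
    define u where "u = (\<lambda>x::real^2. poly profile (x \<bullet> x))"
    define f where "f = (\<lambda>x::real^2. poly (?L k) (x \<bullet> x))"
    have inner_le: "0 \<le> x \<bullet> x \<and> x \<bullet> x \<le> 4" if "x \<in> \<Omega>" for x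
    proof -
      have "norm x \<le> 2" using that assms(2) by simp
      then have "(norm x)\<^sup>2 \<le> 2\<^sup>2" by (intro power_mono) auto
      then show ?thesis by (simp add: dot_square_norm)
    qed
    have "smooth_up_to_boundary \<Omega> u" "smooth_up_to_boundary \<Omega> f"
      unfolding u_def f_def
      by (intro smooth_up_to_boundary_polynomial real_polynomial_function_poly_inner)+
    moreover have "\<forall>x\<in>\<Omega>. laplacian (laplacian u) x - \<gamma> * laplacian u x + k * u x = f x \<and> f x \<ge> 0"
    proof
      fix x assume "x \<in> \<Omega>"
      have "f x \<ge> 0"
        unfolding f_def f_eq using inner_le[OF \<open>x \<in> \<Omega>\<close>] q[of "x \<bullet> x"] by simp
      then show "laplacian (laplacian u) x - \<gamma> * laplacian u x + k * u x = f x \<and> f x \<ge> 0"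
        by (simp add: u_def f_def laplacian_poly_inner)
    qed
    moreover have "\<forall>x\<in>frontier \<Omega>. u x > 0 \<and> normal_deriv (ball_outward_normal 0) u x < 0"
    proof
      fix x assume "x \<in> frontier \<Omega>"
      then have x: "norm x = 2" using assms(2) by (simp add: frontier_ball)
      then have s: "x \<bullet> x = 4" "x \<noteq> 0" by (auto simp: dot_square_norm)
      have "poly (pderiv profile) 4 < 0"
        unfolding profile_coeffs by (simp add: pderiv_pCons)
      then show "u x > 0 \<and> normal_deriv (ball_outward_normal 0) u x < 0"
        unfolding u_def normal_deriv_poly_inner[OF s(2)] by (simp add: s x poly_profile)
    qed
    moreover have "\<forall>x\<in>\<Omega>. u x \<ge> 0"
    proof
      fix x assume "x \<in> \<Omega>"
      show "u x \<ge> 0"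
        unfolding u_def poly_profile using inner_le[OF \<open>x \<in> \<Omega>\<close>] by simp
    qed
    moreover have "\<forall>x. norm x = 1 \<longrightarrow> u x = 0" "\<forall>x. norm x = 1 \<longrightarrow> f x = 0"
      unfolding u_def f_def poly_profile f_eq by (auto simp: dot_square_norm)
    moreover have "f 0 \<noteq> 0"
      unfolding f_def f_eq using q[of 0] by simp
    then have "\<exists>x\<in>\<Omega>. f x \<noteq> 0"
      using assms(2) by (intro bexI[of _ 0]) auto
    ultimately show "\<exists>u f :: real^2 \<Rightarrow> real.
           smooth_up_to_boundary \<Omega> u \<and> smooth_up_to_boundary \<Omega> f \<and>
           (\<forall>x\<in>\<Omega>. laplacian (laplacian u) x - \<gamma> * laplacian u x + k * u x = f x \<and> f x \<ge> 0) \<and>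
           (\<forall>x\<in>frontier \<Omega>. u x > 0 \<and> normal_deriv (ball_outward_normal 0) u x < 0) \<and>
           (\<forall>x\<in>\<Omega>. u x \<ge> 0) \<and>
           (\<forall>x. norm x = 1 \<longrightarrow> u x = 0) \<and>
           (\<forall>x. norm x = 1 \<longrightarrow> f x = 0) \<and>
           (\<exists>x\<in>\<Omega>. f x \<noteq> 0)"
      by blast
  qed (use \<open>c > 0\<close> in simp)
qed

end
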